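(* Let $G=(V,E)$ be a connected undirected graph, $K=\{1,\dots,k\}$ a set of agents, and for every $i\in K$ let $\preceq_i$ be a preference (total preorder) on $E$. Then the spanning tree $T$ returned by the lexicographic Kruskal algorithm (described in the context) is a perfect MST cover, i.e. a minimum spanning tree of $G$ under $\preceq_i$ for every $i\in K$ simultaneously, if and only if the instance admits a perfect MST cover.
   Context: Graphs are finite. A preference $\preceq$ on $E$ is a total preorder; $a\prec b$ means $a$ is strictly cheaper than $b$, and $a\sim b$ means indifference. A weight function $w:E\to\mathbb{R}_{\ge0}$ is consistent with $\preceq$ if for all $a,b\in E$: $w(a)<w(b)$ iff $a\prec b$, and $w(a)=w(b)$ iff $a\sim b$. A spanning tree $T$ of $G$ is a minimum spanning tree (MST) under $\preceq$ if it is a minimum-weight spanning tree under every weight function consistent with $\preceq$. A perfect MST cover is a spanning tree of $G$ that is an MST under $\preceq_i$ for every $i\in K$. The preference $\preceq_i$ partitions $E$ into indifference classes $E_i^1,\dots,E_i^{\kappa_i}$ listed in increasing order of cost; set $\sigma_i(e)=j$ if $e\in E_i^j$, and let $\boldsymbol{\sigma}(e)=(\sigma_1(e),\dots,\sigma_k(e))$. Lexicographic Kruskal algorithm: sort the edges of $E$ in increasing lexicographic order of $\boldsymbol{\sigma}(e)$ (ties broken arbitrarily); then run Kruskal's algorithm in this order: start with $T=\emptyset$, scan the edges in the sorted order, and add the scanned edge to $T$ whenever this creates no cycle in $T$; return $T$. *)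

theory Defs
  imports Complex_Main "HOL-Library.List_Lexorder"
begin

section \<open>Finite undirected graphs\<close>

text \<open>
  A graph has vertex set \<open>V\<close>, edge set \<open>E\<close> and a map \<open>ends\<close> sending each edge to the set of its
  endpoints. Parallel edges and loops (\<open>card (ends e) = 1\<close>) are allowed; simple graphs are the
  instance \<open>ends = (\<lambda>e. e)\<close> with all edges of cardinality 2.
\<close>

definition finite_graph :: "'v set \<Rightarrow> 'e set \<Rightarrow> ('e \<Rightarrow> 'v set) \<Rightarrow> bool" where
  "finite_graph V E ends \<longleftrightarrow>
     finite V \<and> finite E \<and> (\<forall>e\<in>E. ends e \<subseteq> V \<and> card (ends e) \<in> {1, 2})"

definition adjacency :: "('e \<Rightarrow> 'v set) \<Rightarrow> 'e set \<Rightarrow> 'v rel" where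
  "adjacency ends F = {(u, v). \<exists>e\<in>F. ends e = {u, v}}"

definition connected_graph :: "'v set \<Rightarrow> 'e set \<Rightarrow> ('e \<Rightarrow> 'v set) \<Rightarrow> bool" where
  "connected_graph V F ends \<longleftrightarrow>
     V \<noteq> {} \<and> (\<forall>u\<in>V. \<forall>v\<in>V. (u, v) \<in> (adjacency ends F)\<^sup>*)"

text \<open>
  A cycle has distinct vertices \<open>vs\<close> and distinct edges \<open>es\<close>, the \<open>i\<close>-th edge joining the \<open>i\<close>-th
  vertex to the cyclically next one. Length 1 is a loop and length 2 a pair of parallel edges.
\<close>

definition is_cycle :: "('e \<Rightarrow> 'v set) \<Rightarrow> 'e set \<Rightarrow> 'v list \<Rightarrow> 'e list \<Rightarrow> bool" where
  "is_cycle ends F vs es \<longleftrightarrow>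
     es \<noteq> [] \<and> length vs = length es \<and> distinct vs \<and> distinct es \<and> set es \<subseteq> F \<and>
     (\<forall>i<length es. ends (es ! i) = {vs ! i, vs ! (Suc i mod length es)})"

definition cycle_free :: "('e \<Rightarrow> 'v set) \<Rightarrow> 'e set \<Rightarrow> bool" where
  "cycle_free ends F \<longleftrightarrow> (\<nexists>vs es. is_cycle ends F vs es)"

definition spanning_tree :: "'v set \<Rightarrow> 'e set \<Rightarrow> ('e \<Rightarrow> 'v set) \<Rightarrow> 'e set \<Rightarrow> bool" where
  "spanning_tree V E ends T \<longleftrightarrow> T \<subseteq> E \<and> connected_graph V T ends \<and> cycle_free ends T"

section \<open>Preferences and minimum spanning trees\<close>

text \<open>A preference is a relation \<open>r\<close>, where \<open>(a, b) \<in> r\<close> means that \<open>a\<close> is at most as costly as \<open>b\<close>.\<close>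

definition preference_on :: "'e set \<Rightarrow> 'e rel \<Rightarrow> bool" where
  "preference_on E r \<longleftrightarrow> preorder_on E r \<and> total_on E r"

definition cheaper :: "'e rel \<Rightarrow> 'e rel" where
  "cheaper r = {(a, b). (a, b) \<in> r \<and> (b, a) \<notin> r}"

definition indifferent :: "'e rel \<Rightarrow> 'e rel" where
  "indifferent r = {(a, b). (a, b) \<in> r \<and> (b, a) \<in> r}"

text \<open>Weights are only meaningful on \<open>E\<close>; values elsewhere are irrelevant.\<close>

definition consistent_weight :: "'e set \<Rightarrow> 'e rel \<Rightarrow> ('e \<Rightarrow> real) \<Rightarrow> bool" where
  "consistent_weight E r w \<longleftrightarrow>
     (\<forall>e\<in>E. 0 \<le> w e) \<and>
     (\<forall>a\<in>E. \<forall>b\<in>E. (w a < w b \<longleftrightarrow> (a, b) \<in> cheaper r) \<and>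
                       (w a = w b \<longleftrightarrow> (a, b) \<in> indifferent r))"

definition min_weight_spanning_tree ::
    "'v set \<Rightarrow> 'e set \<Rightarrow> ('e \<Rightarrow> 'v set) \<Rightarrow> ('e \<Rightarrow> real) \<Rightarrow> 'e set \<Rightarrow> bool" where
  "min_weight_spanning_tree V E ends w T \<longleftrightarrow>
     spanning_tree V E ends T \<and>
     (\<forall>T'. spanning_tree V E ends T' \<longrightarrow> sum w T \<le> sum w T')"

definition mst_under ::
    "'v set \<Rightarrow> 'e set \<Rightarrow> ('e \<Rightarrow> 'v set) \<Rightarrow> 'e rel \<Rightarrow> 'e set \<Rightarrow> bool" where
  "mst_under V E ends r T \<longleftrightarrow>
     spanning_tree V E ends T \<and>
     (\<forall>w. consistent_weight E r w \<longrightarrow> min_weight_spanning_tree V E ends w T)"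

definition perfect_mst_cover ::
    "'v set \<Rightarrow> 'e set \<Rightarrow> ('e \<Rightarrow> 'v set) \<Rightarrow> nat \<Rightarrow> (nat \<Rightarrow> 'e rel) \<Rightarrow> 'e set \<Rightarrow> bool" where
  "perfect_mst_cover V E ends k r T \<longleftrightarrow>
     spanning_tree V E ends T \<and> (\<forall>i\<in>{1..k}. mst_under V E ends (r i) T)"

section \<open>Indifference classes\<close>

definition lists_classes :: "'e set \<Rightarrow> 'e rel \<Rightarrow> 'e set list \<Rightarrow> bool" where
  "lists_classes E r Cs \<longleftrightarrow>
     distinct Cs \<and> set Cs = E // indifferent r \<and>
     sorted_wrt (\<lambda>C D. \<forall>a\<in>C. \<forall>b\<in>D. (a, b) \<in> cheaper r) Cs"

definition class_list :: "'e set \<Rightarrow> 'e rel \<Rightarrow> 'e set list" where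
  "class_list E r = (THE Cs. lists_classes E r Cs)"

text \<open>Classes are numbered from 1, while list positions start at 0.\<close>

definition class_index :: "'e set \<Rightarrow> 'e rel \<Rightarrow> 'e \<Rightarrow> nat" where
  "class_index E r e =
     (THE j. j \<in> {1..length (class_list E r)} \<and> e \<in> class_list E r ! (j - 1))"

definition class_vector :: "'e set \<Rightarrow> nat \<Rightarrow> (nat \<Rightarrow> 'e rel) \<Rightarrow> 'e \<Rightarrow> nat list" where
  "class_vector E k r e = map (\<lambda>i. class_index E (r i) e) [1..<Suc k]"

text \<open>The definite descriptions above are well defined.\<close>

lemma equiv_indifferent:
  assumes "preference_on E r"
  shows "equiv E (indifferent r)"
proof (rule equivI)
  have r: "r \<subseteq> E \<times> E" "refl_on E r" "trans r"
    using assms by (auto simp: preference_on_def preorder_on_def)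
  show "indifferent r \<subseteq> E \<times> E" using r(1) by (auto simp: indifferent_def)
  show "refl_on E (indifferent r)" using r(2) by (simp add: refl_on_def indifferent_def)
  show "sym (indifferent r)" by (auto simp: indifferent_def intro: symI)
  show "trans (indifferent r)"
    by (rule transI) (auto simp: indifferent_def intro: transD[OF r(3)])
qed

lemma lists_classes_ex1:
  assumes fin: "finite E" and pref: "preference_on E r"
  shows "\<exists>!Cs. lists_classes E r Cs"
proof -
  define f where "f C = card {a \<in> E. \<exists>c\<in>C. (a, c) \<in> r}" for C
  let ?Q = "E // indifferent r"
  have eq: "equiv E (indifferent r)" using equiv_indifferent[OF pref] .
  have r: "r \<subseteq> E \<times> E" "refl_on E r" "trans r" "total_on E r"
    using pref by (auto simp: preference_on_def preorder_on_def)
  have ne: "C \<noteq> {}" "C \<subseteq> E" if "C \<in> ?Q" for C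
    using in_quotient_imp_non_empty[OF eq that] in_quotient_imp_subset[OF eq that] by blast+
  have less: "f C < f D"
    if C: "C \<in> ?Q" and D: "D \<in> ?Q" and CD: "\<forall>a\<in>C. \<forall>b\<in>D. (a, b) \<in> cheaper r" for C D
  proof -
    obtain c d where cd: "c \<in> C" "d \<in> D" using ne(1)[OF C] ne(1)[OF D] by blast
    have "(d, d) \<in> r" "d \<in> E" using cd(2) ne(2)[OF D] r(2) by (auto simp: refl_on_def)
    then have "d \<in> {a \<in> E. \<exists>c\<in>D. (a, c) \<in> r}" using cd(2) by blast
    moreover have "d \<notin> {a \<in> E. \<exists>c\<in>C. (a, c) \<in> r}"
      using cd(2) CD by (auto simp: cheaper_def)
    moreover have "(a, d) \<in> r" if "b \<in> C" "(a, b) \<in> r" for a b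
    proof -
      have "(b, d) \<in> r" using CD cd(2) that(1) by (auto simp: cheaper_def)
      then show ?thesis using transD[OF r(3)] that(2) by blast
    qed
    then have "{a \<in> E. \<exists>c\<in>C. (a, c) \<in> r} \<subseteq> {a \<in> E. \<exists>c\<in>D. (a, c) \<in> r}"
      using cd(2) by blast
    ultimately have "{a \<in> E. \<exists>c\<in>C. (a, c) \<in> r} \<subset> {a \<in> E. \<exists>c\<in>D. (a, c) \<in> r}" by blast
    then show ?thesis unfolding f_def using fin by (intro psubset_card_mono) auto
  qed
  have tot: "(\<forall>a\<in>C. \<forall>b\<in>D. (a, b) \<in> cheaper r) \<or> (\<forall>a\<in>D. \<forall>b\<in>C. (a, b) \<in> cheaper r)"
    if C: "C \<in> ?Q" and D: "D \<in> ?Q" and CD: "C \<noteq> D" for C D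
  proof -
    obtain x y where xy: "x \<in> C" "y \<in> D" using ne(1)[OF C] ne(1)[OF D] by blast
    have same: "(a, b) \<in> r" if "a \<in> X" "b \<in> X" "X \<in> ?Q" for a b X
      using quotient_eq_iff[OF eq that(3) that(3) that(1,2)] by (simp add: indifferent_def)
    have diff: "\<not> ((a, b) \<in> r \<and> (b, a) \<in> r)" if "a \<in> C" "b \<in> D" for a b
      using quotient_eq_iff[OF eq C D that] CD by (simp add: indifferent_def)
    have "x \<noteq> y" using diff[OF xy] same[OF xy(1) xy(1) C] by auto
    then consider "(x, y) \<in> r" | "(y, x) \<in> r"
      using r(4) xy ne(2)[OF C] ne(2)[OF D] by (auto simp: total_on_def)
    then show ?thesis
    proof cases
      case 1
      have "(a, b) \<in> r" if "a \<in> C" "b \<in> D" for a b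
        using transD[OF r(3) transD[OF r(3) same[OF that(1) xy(1) C] 1] same[OF xy(2) that(2) D]] .
      then show ?thesis using diff unfolding cheaper_def by blast
    next
      case 2
      have "(b, a) \<in> r" if "a \<in> C" "b \<in> D" for a b
        using transD[OF r(3) transD[OF r(3) same[OF that(2) xy(2) D] 2] same[OF xy(1) that(1) C]] .
      then show ?thesis using diff unfolding cheaper_def by blast
    qed
  qed
  have inj: "inj_on f ?Q"
  proof (rule inj_onI, rule ccontr)
    fix C D assume CD: "C \<in> ?Q" "D \<in> ?Q" "f C = f D" "C \<noteq> D"
    from tot[OF CD(1,2,4)] show False
      using less[OF CD(1,2)] less[OF CD(2,1)] CD(3) by linarith
  qed
  have sorted_f: "sorted (map f Cs)" if "lists_classes E r Cs" for Cs
  proof -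
    have "sorted_wrt (\<lambda>C D. f C \<le> f D) Cs"
    proof (rule sorted_wrt_mono_rel)
      show "sorted_wrt (\<lambda>C D. \<forall>a\<in>C. \<forall>b\<in>D. (a, b) \<in> cheaper r) Cs"
        using that by (simp add: lists_classes_def)
      fix C D assume "C \<in> set Cs" "D \<in> set Cs" "\<forall>a\<in>C. \<forall>b\<in>D. (a, b) \<in> cheaper r"
      then show "f C \<le> f D" using that less[of C D] by (simp add: lists_classes_def)
    qed
    then show ?thesis by (simp add: sorted_map)
  qed
  have "finite ?Q"
    using fin r(1) by (intro finite_quotient) (auto simp: indifferent_def)
  then obtain xs where xs: "set xs = ?Q" "distinct xs" using finite_distinct_list by blast
  let ?Cs = "sort_key f xs"
  have "sorted_wrt (\<lambda>C D. \<forall>a\<in>C. \<forall>b\<in>D. (a, b) \<in> cheaper r) ?Cs"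
    unfolding sorted_wrt_iff_nth_less
  proof (intro allI impI)
    fix i j assume ij: "i < j" "j < length ?Cs"
    have mem: "?Cs ! i \<in> ?Q" "?Cs ! j \<in> ?Q"
      using ij xs(1) nth_mem[of i ?Cs] nth_mem[of j ?Cs] by auto
    have dist: "?Cs ! i \<noteq> ?Cs ! j" using ij xs(2) by (simp add: nth_eq_iff_index_eq)
    have "f (?Cs ! i) \<le> f (?Cs ! j)"
      using sorted_nth_mono[OF sorted_sort_key[of f xs], of i j] ij by simp
    then show "\<forall>a\<in>?Cs ! i. \<forall>b\<in>?Cs ! j. (a, b) \<in> cheaper r"
      using tot[OF mem dist] less[OF mem(2,1)] by linarith
  qed
  then have ex: "lists_classes E r ?Cs" using xs by (simp add: lists_classes_def)
  show ?thesis
  proof (rule ex1I, rule ex)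
    fix Ds assume Ds: "lists_classes E r Ds"
    show "Ds = ?Cs"
    proof (rule map_sorted_distinct_set_unique[of f])
      show "inj_on f (set Ds \<union> set ?Cs)" using Ds ex inj by (simp add: lists_classes_def)
      show "sorted (map f Ds)" "sorted (map f ?Cs)" using sorted_f Ds ex by blast+
      show "distinct (map f Ds)" "distinct (map f ?Cs)" "set Ds = set ?Cs"
        using Ds ex inj by (simp_all add: lists_classes_def distinct_map)
    qed
  qed
qed

lemma class_index_ex1:
  assumes fin: "finite E" and pref: "preference_on E r" and e: "e \<in> E"
  shows "\<exists>!j. j \<in> {1..length (class_list E r)} \<and> e \<in> class_list E r ! (j - 1)"
proof -
  let ?Cs = "class_list E r"
  have Cs: "distinct ?Cs" "set ?Cs = E // indifferent r"
    using theI'[OF lists_classes_ex1[OF fin pref], folded class_list_def]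
    unfolding lists_classes_def by blast+
  have eq: "equiv E (indifferent r)" using equiv_indifferent[OF pref] .
  have "\<Union> (set ?Cs) = E" using Cs(2) Union_quotient[OF eq] by simp
  then obtain i where i: "i < length ?Cs" "e \<in> ?Cs ! i"
    using e by (metis UnionE in_set_conv_nth)
  show ?thesis
  proof (rule ex1I[of _ "Suc i"])
    show "Suc i \<in> {1..length ?Cs} \<and> e \<in> ?Cs ! (Suc i - 1)" using i by auto
    fix j assume j: "j \<in> {1..length ?Cs} \<and> e \<in> ?Cs ! (j - 1)"
    then have lt: "j - 1 < length ?Cs" by auto
    have "?Cs ! (j - 1) \<in> E // indifferent r" "?Cs ! i \<in> E // indifferent r"
      using lt i(1) Cs(2) nth_mem by blast+
    then have "?Cs ! (j - 1) = ?Cs ! i"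
      using quotient_disj[OF eq] i(2) j by blast
    then have "j - 1 = i" using Cs(1) i(1) lt by (metis nth_eq_iff_index_eq)
    then show "j = Suc i" using j by auto
  qed
qed

section \<open>Lexicographic Kruskal algorithm\<close>

text \<open>
  The order on class vectors is the lexicographic list order. An edge set has one lexicographically
  sorted enumeration for each way of breaking ties.
\<close>

definition lex_sorted_enum :: "'e set \<Rightarrow> nat \<Rightarrow> (nat \<Rightarrow> 'e rel) \<Rightarrow> 'e list \<Rightarrow> bool" where
  "lex_sorted_enum E k r es \<longleftrightarrow>
     distinct es \<and> set es = E \<and> sorted (map (class_vector E k r) es)"

definition kruskal :: "('e \<Rightarrow> 'v set) \<Rightarrow> 'e list \<Rightarrow> 'e set" where
  "kruskal ends es =
     fold (\<lambda>e T. if cycle_free ends (insert e T) then insert e T else T) es {}"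

end

theory Submission
  imports Defs
begin

text \<open>
  The Kruskal tree is reached from an arbitrary perfect cover \<open>T\<close> by exchanges. Follow the scan as long
  as Kruskal's set and \<open>T\<close> agree; at the first edge \<open>e\<close> taken by Kruskal but missing from \<open>T\<close>, the cycle
  in \<open>T + e\<close> has an edge \<open>f\<close> that Kruskal has not taken, and \<open>f\<close> is scanned after \<open>e\<close>, so
  \<open>\<sigma>(e) \<le> \<sigma>(f)\<close> lexicographically. Since \<open>T\<close> is minimum for every agent, \<open>\<sigma>\<^sub>i(f) \<le> \<sigma>\<^sub>i(e)\<close> for every \<open>i\<close>.
  Hence \<open>\<sigma>(e) = \<sigma>(f)\<close>, all agents are indifferent between \<open>e\<close> and \<open>f\<close>, and \<open>T - f + e\<close> is again a
  perfect cover, which now agrees with Kruskal's set up to and including \<open>e\<close>.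
\<close>

section \<open>Reachability and cycles\<close>

lemma adjacency_mono: "F \<subseteq> G \<Longrightarrow> adjacency ends F \<subseteq> adjacency ends G"
  by (auto simp: adjacency_def)

lemma reachable_mono: "F \<subseteq> G \<Longrightarrow> (adjacency ends F)\<^sup>* \<subseteq> (adjacency ends G)\<^sup>*"
  by (intro rtrancl_mono adjacency_mono)

lemma reachable_sym: "(u, v) \<in> (adjacency ends F)\<^sup>* \<Longrightarrow> (v, u) \<in> (adjacency ends F)\<^sup>*"
proof -
  have "sym (adjacency ends F)"
    by (rule symI) (auto simp: adjacency_def insert_commute)
  then show "(u, v) \<in> (adjacency ends F)\<^sup>* \<Longrightarrow> (v, u) \<in> (adjacency ends F)\<^sup>*"
    by (meson sym_rtrancl symD)
qed

text \<open>Every step along \<open>f\<close>, in either direction, can be replaced by a walk in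
  \<open>F\<close> between its ends.\<close>

lemma reachable_insert_redundant:
  assumes "ends f = {x, y}" and "(x, y) \<in> (adjacency ends F)\<^sup>*"
  shows "(adjacency ends (insert f F))\<^sup>* = (adjacency ends F)\<^sup>*"
proof
  have "adjacency ends (insert f F) \<subseteq> (adjacency ends F)\<^sup>*"
    using assms reachable_sym[OF assms(2)]
    by (auto simp: adjacency_def doubleton_eq_iff intro: r_into_rtrancl)
  then show "(adjacency ends (insert f F))\<^sup>* \<subseteq> (adjacency ends F)\<^sup>*"
    by (rule rtrancl_subset_rtrancl)
  show "(adjacency ends F)\<^sup>* \<subseteq> (adjacency ends (insert f F))\<^sup>*"
    by (intro reachable_mono) blast
qed

lemma cycle_free_subset: "cycle_free ends G \<Longrightarrow> F \<subseteq> G \<Longrightarrow> cycle_free ends F"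
  unfolding cycle_free_def is_cycle_def by (meson subset_trans)

text \<open>The rest of the cycle joins the ends of \<open>f\<close>; for a loop this walk is
  empty.\<close>

lemma cycle_edge_redundant:
  assumes cyc: "is_cycle ends F vs es" and f: "f \<in> set es"
  obtains x y where "ends f = {x, y}" "(x, y) \<in> (adjacency ends (F - {f}))\<^sup>*"
proof -
  let ?n = "length es" and ?R = "(adjacency ends (F - {f}))\<^sup>*"
  obtain i where i: "i < ?n" "es ! i = f" using f by (auto simp: in_set_conv_nth)
  have es: "distinct es" "set es \<subseteq> F"
    and edge: "\<And>j. j < ?n \<Longrightarrow> ends (es ! j) = {vs ! j, vs ! (Suc j mod ?n)}"
    using cyc by (auto simp: is_cycle_def)
  \<comment> \<open>Walk round the cycle from the vertex after \<open>f\<close>; with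
    \<open>j = ?n - 1\<close> the walk arrives at \<open>vs ! i\<close>, the other end of
    \<open>f\<close>.\<close>
  have "(vs ! (Suc i mod ?n), vs ! ((Suc i + j) mod ?n)) \<in> ?R" if "j < ?n" for j
    using that
  proof (induction j)
    case (Suc j)
    let ?m = "(Suc i + j) mod ?n"
    have m: "?m < ?n" by (rule mod_less_divisor) (use i in linarith)
    \<comment> \<open>\<open>Suc i + j\<close> lies strictly between \<open>i\<close> and
      \<open>i + ?n\<close>, so the walk has not come round to \<open>f\<close> again.\<close>
    have "?m \<noteq> i"
    proof (cases "Suc i + j < ?n")
      case False
      then have "?m = Suc i + j - ?n" using Suc.prems i(1) by (subst le_mod_geq) auto
      then show ?thesis using Suc.prems False by linarith
    qed simp
    then have "es ! ?m \<in> F - {f}"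
      using m i es nth_mem[OF m] by (auto simp: nth_eq_iff_index_eq)
    moreover have "ends (es ! ?m) = {vs ! ?m, vs ! ((Suc i + Suc j) mod ?n)}"
      using edge[OF m] by (simp add: mod_Suc_eq)
    ultimately have "(vs ! ?m, vs ! ((Suc i + Suc j) mod ?n)) \<in> adjacency ends (F - {f})"
      unfolding adjacency_def by blast
    then show ?case using Suc by (meson Suc_lessD rtrancl.rtrancl_into_rtrancl)
  qed simp
  moreover have "Suc i + (?n - 1) = i + ?n" "?n - 1 < ?n" "(i + ?n) mod ?n = i" using i(1) by auto
  ultimately have "(vs ! (Suc i mod ?n), vs ! i) \<in> ?R" by metis
  then show ?thesis
    using that edge[OF i(1)] i(2) reachable_sym by metis
qed

text \<open>Closes a shortest path into a cycle; minimality of the length makes its vertices distinct.\<close>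

lemma redundant_edge_cycle:
  assumes uv: "ends e = {u, v}" and e: "e \<notin> F" and reach: "(u, v) \<in> (adjacency ends F)\<^sup>*"
  shows "\<not> cycle_free ends (insert e F)"
proof -
  let ?A = "adjacency ends F"
  define n where "n = (LEAST n. (u, v) \<in> ?A ^^ n)"
  have "\<exists>n. (u, v) \<in> ?A ^^ n" using reach by (simp add: rtrancl_power)
  then have n: "(u, v) \<in> ?A ^^ n" unfolding n_def by (rule LeastI_ex)
  have n_le: "n \<le> m" if "(u, v) \<in> ?A ^^ m" for m
    unfolding n_def using that by (rule Least_le)
  obtain p where p: "p 0 = u" "p n = v" and step: "\<And>i. i < n \<Longrightarrow> (p i, p (Suc i)) \<in> ?A"
    using n by (auto simp: relpow_fun_conv)
  have part: "(p i, p (i + d)) \<in> ?A ^^ d" if "i + d \<le> n" for i d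
    using that
  proof (induction d)
    case (Suc d)
    then show ?case using step[of "i + d"] by auto
  qed simp
  \<comment> \<open>A repeated vertex would allow the steps from \<open>i\<close> to
    \<open>j\<close> to be cut out.\<close>
  have neq: "p i \<noteq> p j" if "i < j" "j \<le> n" for i j
  proof
    assume eq: "p i = p j"
    have "(u, p i) \<in> ?A ^^ i" using part[of 0 i] that p by simp
    moreover have "(p i, v) \<in> ?A ^^ (n - j)" using part[of j "n - j"] that p eq by simp
    ultimately have "(u, v) \<in> ?A ^^ (i + (n - j))" by (auto simp: relpow_add)
    from n_le[OF this] that show False by simp
  qed
  then have p_eq: "p i = p j \<longleftrightarrow> i = j" if "i \<le> n" "j \<le> n" for i j
    using that by (metis linorder_neqE_nat)
  have "\<forall>i. \<exists>g. i < n \<longrightarrow> g \<in> F \<and> ends g = {p i, p (Suc i)}"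
    using step by (auto simp: adjacency_def)
  then obtain g where g: "\<And>i. i < n \<Longrightarrow> g i \<in> F \<and> ends (g i) = {p i, p (Suc i)}" by metis
  have inj: "inj_on g {..<n}"
  proof (rule inj_onI)
    fix i j assume ij: "i \<in> {..<n}" "j \<in> {..<n}" "g i = g j"
    then have "{p i, p (Suc i)} = {p j, p (Suc j)}" using g by (metis lessThan_iff)
    then show "i = j" using ij by (auto simp: doubleton_eq_iff p_eq)
  qed
  \<comment> \<open>The edge \<open>e\<close> at position \<open>n\<close> leads from
    \<open>p n = v\<close> back to \<open>p 0 = u\<close>. If \<open>u = v\<close>, then
    \<open>n = 0\<close> and the cycle is the loop \<open>e\<close>.\<close>
  let ?vs = "map p [0..<Suc n]" and ?es = "map g [0..<n] @ [e]"
  have "is_cycle ends (insert e F) ?vs ?es"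
    unfolding is_cycle_def
  proof (intro conjI allI impI)
    show "distinct ?vs"
      by (auto simp: distinct_map inj_on_def p_eq simp del: upt_Suc)
    show "distinct ?es"
      using inj g e by (auto simp: distinct_map lessThan_atLeast0)
    show "set ?es \<subseteq> insert e F" using g by auto
    fix i assume i: "i < length ?es"
    show "ends (?es ! i) = {?vs ! i, ?vs ! (Suc i mod length ?es)}"
    proof (cases "i = n")
      case True
      then show ?thesis using uv p by (auto simp: nth_append simp del: upt_Suc)
    next
      case False
      then show ?thesis using i g[of i] by (auto simp: nth_append simp del: upt_Suc)
    qed
  qed auto
  then show ?thesis by (auto simp: cycle_free_def)
qed

section \<open>Spanning trees\<close>

lemma connected_remove_cycle_edge:
  assumes con: "connected_graph V F ends" and cyc: "is_cycle ends F vs es" and f: "f \<in> set es"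
  shows "connected_graph V (F - {f}) ends"
proof -
  obtain x y where "ends f = {x, y}" "(x, y) \<in> (adjacency ends (F - {f}))\<^sup>*"
    using cycle_edge_redundant[OF cyc f] .
  from reachable_insert_redundant[OF this] have
    "(adjacency ends F)\<^sup>* = (adjacency ends (F - {f}))\<^sup>*"
    using cyc f by (metis insert_Diff is_cycle_def subsetD)
  then show ?thesis using con by (simp add: connected_graph_def)
qed

text \<open>A connected edge set of least cardinality is cycle-free, since deleting an edge of a
  cycle keeps it connected. This supplies an initial tree for the exchanges when no perfect cover is
  given.\<close>

lemma spanning_tree_exists:
  assumes fin: "finite E" and con: "connected_graph V E ends"
  shows "\<exists>T. spanning_tree V E ends T"
proof -
  let ?P = "\<lambda>F. F \<subseteq> E \<and> connected_graph V F ends"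
  obtain T where T: "?P T" and min: "\<And>F. ?P F \<Longrightarrow> card T \<le> card F"
    using con arg_min_natI[of ?P E card] arg_min_nat_le[of ?P _ card] by blast
  have "cycle_free ends T"
    unfolding cycle_free_def
  proof (intro notI, elim exE)
    fix vs es assume cyc: "is_cycle ends T vs es"
    then obtain f where f: "f \<in> set es" "f \<in> T"
      by (metis is_cycle_def last_in_set subsetD)
    have "?P (T - {f})" using connected_remove_cycle_edge[OF _ cyc f(1)] T by blast
    from min[OF this] show False
      using f(2) T fin by (metis card_Diff1_less finite_subset linorder_not_less)
  qed
  then show ?thesis using T by (auto simp: spanning_tree_def)
qed

text \<open>\<open>T\<close> with \<open>e\<close> contains a cycle, which cannot lie inside the
  cycle-free set \<open>K\<close>; any edge of it outside \<open>K\<close> can serve as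
  \<open>f\<close>. In the application \<open>K\<close> is Kruskal's current set together with
  \<open>e\<close>.\<close>

lemma spanning_tree_exchange:
  assumes G: "finite_graph V E ends" and T: "spanning_tree V E ends T"
    and K: "cycle_free ends K" "e \<in> K" and e: "e \<in> E" "e \<notin> T"
  obtains f where "f \<in> T" "f \<notin> K" "spanning_tree V E ends (insert e (T - {f}))"
proof -
  have TE: "T \<subseteq> E" "connected_graph V T ends" "cycle_free ends T"
    using T by (auto simp: spanning_tree_def)
  have "ends e \<subseteq> V" "card (ends e) \<in> {1, 2}" using G e by (auto simp: finite_graph_def)
  then obtain u v where uv: "ends e = {u, v}" "u \<in> V" "v \<in> V"
    by (auto simp: card_1_singleton_iff card_2_iff)
  then have "(u, v) \<in> (adjacency ends T)\<^sup>*" using TE(2) by (simp add: connected_graph_def)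
  from redundant_edge_cycle[OF uv(1) e(2) this]
  obtain vs es where cyc: "is_cycle ends (insert e T) vs es" by (auto simp: cycle_free_def)
  have "\<not> set es \<subseteq> K" using K(1) cyc unfolding cycle_free_def is_cycle_def by blast
  then obtain f where f: "f \<in> set es" "f \<notin> K" by blast
  have ef: "e \<noteq> f" "f \<in> T" using f K(2) cyc by (auto simp: is_cycle_def)
  have T': "insert e T - {f} = insert e (T - {f})" using ef by blast
  have con: "connected_graph V (insert e (T - {f})) ends"
  proof -
    have "connected_graph V (insert e T) ends"
      using TE(2) reachable_mono[of T "insert e T" ends]
      unfolding connected_graph_def by blast
    from connected_remove_cycle_edge[OF this cyc f(1)] show ?thesis by (simp add: T')
  qed
  \<comment> \<open>A new cycle would have to use \<open>e\<close>, making \<open>e\<close>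
    redundant over \<open>T - {f}\<close>. The rest of the original cycle joins the ends of
    \<open>f\<close> in \<open>insert e (T - {f})\<close>, hence already in \<open>T - {f}\<close>,
    so \<open>f\<close> would close a cycle in \<open>T\<close>.\<close>
  have "cycle_free ends (insert e (T - {f}))"
    unfolding cycle_free_def
  proof (intro notI, elim exE)
    fix vs' es' assume cyc': "is_cycle ends (insert e (T - {f})) vs' es'"
    have "e \<in> set es'"
    proof (rule ccontr)
      assume "e \<notin> set es'"
      then have "is_cycle ends T vs' es'" using cyc' by (auto simp: is_cycle_def)
      then show False using TE(3) by (auto simp: cycle_free_def)
    qed
    from cycle_edge_redundant[OF cyc' this]
    obtain a b where ab: "ends e = {a, b}"
      "(a, b) \<in> (adjacency ends (insert e (T - {f}) - {e}))\<^sup>*" .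
    have "insert e (T - {f}) - {e} = T - {f}" using e by blast
    with ab have eq: "(adjacency ends (insert e (T - {f})))\<^sup>* = (adjacency ends (T - {f}))\<^sup>*"
      by (intro reachable_insert_redundant) auto
    obtain x y where xy: "ends f = {x, y}" "(x, y) \<in> (adjacency ends (insert e T - {f}))\<^sup>*"
      using cycle_edge_redundant[OF cyc f(1)] .
    have "\<not> cycle_free ends (insert f (T - {f}))"
      using xy by (intro redundant_edge_cycle) (auto simp: T' eq)
    then show False using TE(3) ef(2) by (simp add: insert_absorb)
  qed
  then show ?thesis using that ef f con e TE(1) by (auto simp: spanning_tree_def)
qed

section \<open>Kruskal's algorithm\<close>

lemma kruskal_Nil: "kruskal ends [] = {}"
  by (simp add: kruskal_def)

lemma kruskal_snoc: "kruskal ends (xs @ [e]) =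
    (if cycle_free ends (insert e (kruskal ends xs)) then insert e (kruskal ends xs)
     else kruskal ends xs)"
  by (simp add: kruskal_def)

text \<open>The property \<open>P\<close> is abstract to allow two uses: the trivial property shows
  that the output is a spanning tree at all, and being a perfect cover gives the main equivalence.
  Closure of \<open>P\<close> is demanded only for exchanges in which \<open>e\<close> is scanned
  before \<open>f\<close>.\<close>

lemma kruskal_exchange_induct:
  assumes G: "finite_graph V E ends" and es: "distinct es" "set es = E"
    and T: "spanning_tree V E ends T" "P T"
    and exch: "\<And>T e f xs ys. \<lbrakk>spanning_tree V E ends T; P T; e \<notin> T; f \<in> T;
      spanning_tree V E ends (insert e (T - {f})); es = xs @ e # ys; f \<in> set ys\<rbrakk>
      \<Longrightarrow> P (insert e (T - {f}))"
  shows "spanning_tree V E ends (kruskal ends es) \<and> P (kruskal ends es)"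
proof -
  \<comment> \<open>Invariant of the scan: Kruskal's set is the trace on the scanned prefix of some
    spanning tree satisfying \<open>P\<close>; this tree may change with the prefix.\<close>
  have "\<exists>T. spanning_tree V E ends T \<and> P T \<and> kruskal ends xs = T \<inter> set xs"
    if "es = xs @ ys" for xs ys
    using that
  proof (induction xs arbitrary: ys rule: rev_induct)
    case Nil
    then show ?case using T by (auto simp: kruskal_Nil)
  next
    case (snoc e xs)
    then obtain T where T: "spanning_tree V E ends T" "P T"
      and agree: "kruskal ends xs = T \<inter> set xs" by fastforce
    let ?K = "insert e (kruskal ends xs)"
    consider "e \<in> T" | "e \<notin> T" "\<not> cycle_free ends ?K" | "e \<notin> T" "cycle_free ends ?K" by blast
    then show ?case
    proof cases
      case 1
      then have "cycle_free ends ?K"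
        using T(1) agree cycle_free_subset[of ends T ?K] by (auto simp: spanning_tree_def)
      then show ?thesis using 1 T agree by (auto simp: kruskal_snoc)
    next
      case 2
      then show ?thesis using T agree by (auto simp: kruskal_snoc)
    next
      case 3
      have e: "e \<in> E" using snoc.prems es by auto
      obtain f where f: "f \<in> T" "f \<notin> ?K" and T': "spanning_tree V E ends (insert e (T - {f}))"
        using spanning_tree_exchange[OF G T(1) 3(2) _ e 3(1)] by blast
      \<comment> \<open>A scanned edge of \<open>T\<close> would be in Kruskal's set by
        \<open>agree\<close>. Hence \<open>f\<close> is still to come, and removing it leaves the
        agreement on \<open>xs\<close> intact.\<close>
      have "f \<notin> set xs" "f \<noteq> e" using f agree by auto
      moreover have "f \<in> set es" using f T(1) es by (auto simp: spanning_tree_def)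
      ultimately have "f \<in> set ys" using snoc.prems by simp
      then have "P (insert e (T - {f}))"
        using exch[OF T 3(1) f(1) T'] snoc.prems by simp
      moreover have "kruskal ends (xs @ [e]) = insert e (T - {f}) \<inter> set (xs @ [e])"
        using 3 agree \<open>f \<notin> set xs\<close> by (auto simp: kruskal_snoc)
      ultimately show ?thesis using T' by blast
    qed
  qed
  from this[of es "[]"] obtain T' where
    T': "spanning_tree V E ends T'" "P T'" "kruskal ends es = T' \<inter> set es" by auto
  then have "kruskal ends es = T'" using es by (auto simp: spanning_tree_def)
  then show ?thesis using T' by simp
qed

section \<open>Class indices as weights\<close>

text \<open>The classes are listed by increasing cost, so a smaller index means strictly cheaper and
  an equal index means the same class. This links the vectors that Kruskal sorts by to minimality:
  an MST is in particular minimum for these weights.\<close>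

lemma consistent_class_index:
  assumes fin: "finite E" and pref: "preference_on E r"
  shows "consistent_weight E r (\<lambda>e. real (class_index E r e))"
proof -
  let ?Cs = "class_list E r" and ?\<sigma> = "class_index E r"
  have Cs: "set ?Cs = E // indifferent r"
    "sorted_wrt (\<lambda>C D. \<forall>a\<in>C. \<forall>b\<in>D. (a, b) \<in> cheaper r) ?Cs"
    using theI'[OF lists_classes_ex1[OF fin pref], folded class_list_def]
    unfolding lists_classes_def by blast+
  have eq: "equiv E (indifferent r)" using equiv_indifferent[OF pref] .
  have mem: "?\<sigma> e \<in> {1..length ?Cs}" "e \<in> ?Cs ! (?\<sigma> e - 1)" if "e \<in> E" for e
    using theI'[OF class_index_ex1[OF fin pref that], folded class_index_def] by blast+
  have less: "(a, b) \<in> cheaper r" if "a \<in> E" "b \<in> E" "?\<sigma> a < ?\<sigma> b" for a b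
  proof -
    have "?\<sigma> a - 1 < ?\<sigma> b - 1" "?\<sigma> b - 1 < length ?Cs"
      using mem(1)[OF that(1)] mem(1)[OF that(2)] that(3) by auto
    then show ?thesis
      using Cs(2) mem(2)[OF that(1)] mem(2)[OF that(2)] unfolding sorted_wrt_iff_nth_less by blast
  qed
  have equal: "(a, b) \<in> indifferent r" if "a \<in> E" "b \<in> E" "?\<sigma> a = ?\<sigma> b" for a b
  proof -
    have "?\<sigma> a - 1 < length ?Cs" using mem(1)[OF that(1)] by auto
    then have "?Cs ! (?\<sigma> a - 1) \<in> E // indifferent r" using Cs(1) nth_mem by blast
    from quotient_eq_iff[OF eq this this] show ?thesis using mem(2) that by metis
  qed
  \<comment> \<open>The converses follow by trichotomy, as cheaper, dearer and indifferent exclude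
    one another.\<close>
  have "(?\<sigma> a < ?\<sigma> b \<longleftrightarrow> (a, b) \<in> cheaper r) \<and> (?\<sigma> a = ?\<sigma> b \<longleftrightarrow> (a, b) \<in> indifferent r)"
    if "a \<in> E" "b \<in> E" for a b
  proof (cases "?\<sigma> a" "?\<sigma> b" rule: linorder_cases)
    case less
    then show ?thesis using \<open>\<And>a b. _ \<Longrightarrow> _ \<Longrightarrow> ?\<sigma> a < ?\<sigma> b \<Longrightarrow> _\<close>[OF that]
      by (auto simp: cheaper_def indifferent_def)
  next
    case equal
    then show ?thesis using \<open>\<And>a b. _ \<Longrightarrow> _ \<Longrightarrow> ?\<sigma> a = ?\<sigma> b \<Longrightarrow> _\<close>[OF that]
      by (auto simp: cheaper_def indifferent_def)
  next
    case greater
    then show ?thesis using \<open>\<And>a b. _ \<Longrightarrow> _ \<Longrightarrow> ?\<sigma> a < ?\<sigma> b \<Longrightarrow> _\<close>[OF that(2,1)]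
      by (auto simp: cheaper_def indifferent_def)
  qed
  then show ?thesis by (simp add: consistent_weight_def)
qed

text \<open>At a first difference the lexicographic order would make the entry of \<open>xs\<close>
  smaller, the pointwise order larger.\<close>

lemma list_le_pointwise_ge_eq:
  fixes xs ys :: "'a :: linorder list"
  assumes "list_all2 (\<ge>) xs ys" and "xs \<le> ys"
  shows "xs = ys"
  using assms by (induction rule: list_all2_induct) auto

lemma perfect_mst_cover_exchange:
  assumes fin: "finite E" and pref: "\<forall>i\<in>{1..k}. preference_on E (r i)"
    and T: "perfect_mst_cover V E ends k r T" and e: "e \<in> E" "e \<notin> T" and f: "f \<in> T"
    and T': "spanning_tree V E ends (insert e (T - {f}))"
    and le: "class_vector E k r e \<le> class_vector E k r f"
  shows "perfect_mst_cover V E ends k r (insert e (T - {f}))"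
proof -
  have TE: "T \<subseteq> E" using T by (auto simp: perfect_mst_cover_def spanning_tree_def)
  then have fT: "finite T" using fin finite_subset by blast
  have sum_T': "sum w (insert e (T - {f})) = sum w T - w f + w e" for w :: "_ \<Rightarrow> real"
    using fT e f by (simp add: sum_diff1)
  have min: "min_weight_spanning_tree V E ends w T"
    if "i \<in> {1..k}" "consistent_weight E (r i) w" for i w
    using T that by (auto simp: perfect_mst_cover_def mst_under_def)
  \<comment> \<open>The exchange cannot lower the total class index of agent \<open>i\<close>, for
    which \<open>T\<close> is minimum.\<close>
  have "class_index E (r i) f \<le> class_index E (r i) e" if i: "i \<in> {1..k}" for i
  proof -
    let ?w = "\<lambda>e. real (class_index E (r i) e)"
    have "sum ?w T \<le> sum ?w (insert e (T - {f}))"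
      using min[OF i consistent_class_index[OF fin]] pref i T'
      by (auto simp: min_weight_spanning_tree_def)
    then show ?thesis by (simp add: sum_T')
  qed
  then have "list_all2 (\<ge>) (class_vector E k r e) (class_vector E k r f)"
    by (auto simp: class_vector_def list_all2_conv_all_nth simp del: upt_Suc)
  then have "class_vector E k r e = class_vector E k r f"
    using le by (rule list_le_pointwise_ge_eq)
  then have eq: "class_index E (r i) e = class_index E (r i) f" if "i \<in> {1..k}" for i
    using that by (simp add: class_vector_def del: upt_Suc)
  \<comment> \<open>Equal indices mean indifference, so the exchange preserves the weight of
    \<open>T\<close> under every consistent weight.\<close>
  have "mst_under V E ends (r i) (insert e (T - {f}))" if i: "i \<in> {1..k}" for i
    unfolding mst_under_def
  proof (intro conjI allI impI T')
    fix w assume w: "consistent_weight E (r i) w"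
    have "(e, f) \<in> indifferent (r i)"
      using consistent_class_index[OF fin, of "r i"] pref i e f TE eq[OF i]
      unfolding consistent_weight_def by (metis subsetD)
    then have "w e = w f" using w e f TE by (auto simp: consistent_weight_def)
    then show "min_weight_spanning_tree V E ends w (insert e (T - {f}))"
      using min[OF i w] T' by (simp add: min_weight_spanning_tree_def sum_T')
  qed
  then show ?thesis using T' by (simp add: perfect_mst_cover_def)
qed

theorem theorem3:
  fixes V :: "'v set" and E :: "'e set" and ends :: "'e \<Rightarrow> 'v set"
    and k :: nat and r :: "nat \<Rightarrow> 'e rel" and es :: "'e list"
  assumes "finite_graph V E ends"
    and "connected_graph V E ends"
    and "\<forall>i\<in>{1..k}. preference_on E (r i)"
    and "lex_sorted_enum E k r es"
  shows "spanning_tree V E ends (kruskal ends es) \<and>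
    (perfect_mst_cover V E ends k r (kruskal ends es) \<longleftrightarrow>
      (\<exists>T. perfect_mst_cover V E ends k r T))"
proof (intro conjI iffI)
  have fin: "finite E" using assms(1) by (simp add: finite_graph_def)
  have es: "distinct es" "set es = E" "sorted (map (class_vector E k r) es)"
    using assms(4) by (auto simp: lex_sorted_enum_def)
  show "spanning_tree V E ends (kruskal ends es)"
    using spanning_tree_exists[OF fin assms(2)]
      kruskal_exchange_induct[OF assms(1) es(1,2), of _ "\<lambda>_. True"] by blast
  show "\<exists>T. perfect_mst_cover V E ends k r T" if "perfect_mst_cover V E ends k r (kruskal ends es)"
    using that by blast
  show "perfect_mst_cover V E ends k r (kruskal ends es)"
    if "\<exists>T. perfect_mst_cover V E ends k r T"
  proof -
    obtain T where T: "perfect_mst_cover V E ends k r T" using \<open>\<exists>T. _\<close> by blast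
    then have "spanning_tree V E ends T" by (simp add: perfect_mst_cover_def)
    then have "spanning_tree V E ends (kruskal ends es) \<and>
      perfect_mst_cover V E ends k r (kruskal ends es)"
    proof (rule kruskal_exchange_induct[where P = "perfect_mst_cover V E ends k r",
          OF assms(1) es(1,2) _ T])
      fix T e f xs ys
      assume *: "perfect_mst_cover V E ends k r T" "e \<notin> T" "f \<in> T"
        "spanning_tree V E ends (insert e (T - {f}))" "es = xs @ e # ys" "f \<in> set ys"
      \<comment> \<open>The sorted scan enters only here: \<open>f\<close> comes after
        \<open>e\<close> in \<open>es\<close>.\<close>
      then have "e \<in> E" "class_vector E k r e \<le> class_vector E k r f"
        using es by (auto simp: sorted_append)
      then show "perfect_mst_cover V E ends k r (insert e (T - {f}))"
        using perfect_mst_cover_exchange[OF fin assms(3) *(1) _ *(2,3,4)] by blast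
    qed
    then show ?thesis by blast
  qed
qed

end
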